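(* Let $s$ and $l$ be integers with $s\geq l\geq 0$, and let $j$ be an integer. Then \begin{align*} &\sum_{m=0}^{\lfloor (l-1)/2\rfloor}\sum_{i=2m}^{l-1} (-2)^{i-2m}\left\{\binom{s-l}{i-2m,\,j-l+m,\,s-i-j+m} \, \beta_{m}(s,l,i+j-l,l-i)\right.\\ &\qquad\qquad+\left.\binom{s-l}{i-2m,\,j-i+m,\,s-l-j+m} \, \beta_{m}(s,l,l+j-i,i-l)\right\}\\ &\qquad\qquad+\sum_{m=0}^{\lfloor l/2\rfloor}(-2)^{l-2m}\binom{s-l}{l-2m,\,j-l+m,\,s-l-j+m} \, \beta_{m}(s,l,j,0)=\binom{s}{j}, \end{align*} where $\lfloor x\rfloor$ denotes the largest integer $\leq x$. (In particular the left-hand side does not depend on $l$.)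
   Context: Multinomial coefficients: for a positive integer $k$ and integers $r_1,\dots,r_k$ with $n=r_1+\cdots+r_k\geq 0$, $\binom{n}{r_1,\dots,r_k}=\frac{n!}{r_1!\cdots r_k!}$ if all $r_i\geq 0$, and $\binom{n}{r_1,\dots,r_k}=0$ otherwise. Binomial coefficients: for $n\geq 0$ and any integer $r$, $\binom{n}{r}=\binom{n}{r,\,n-r}$ (so it is $0$ if $r<0$ or $r>n$). For an integer $b$ put $b_{+}=\frac{|b|+b}{2}$ and $b_{-}=\frac{|b|-b}{2}$. For integers $a,b,s,l,m$ with $s\geq a\geq 0$ and $s\geq l$, define $$\beta_{m}(s,l,a,b)=\sum_{n=0}^{|b|+m}\binom{s-a}{b_{+}+m-n}\binom{a}{b_{-}+m-n}\binom{s-l+n}{n}$$ (an empty sum is $0$). A product of a vanishing multinomial coefficient with a $\beta$-term is taken to be $0$; whenever the multinomial coefficient in a term is nonzero, the accompanying $\beta$ has arguments satisfying $s\geq a\geq 0$. *)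

theory Defs
  imports Complex_Main
begin

text \<open>
  \<open>multinom n rs\<close> is only meaningful when \<open>n = sum_list rs\<close>. The lower entries are arbitrary
  integers; the coefficient vanishes as soon as one of them is negative. Values are taken in
  \<open>rat\<close> so that the quotient of factorials is an honest division.
\<close>

definition multinom :: "int \<Rightarrow> int list \<Rightarrow> rat" where
  "multinom n rs =
     (if \<forall>r \<in> set rs. r \<ge> 0
      then fact (nat n) / (\<Prod>r\<leftarrow>rs. fact (nat r))
      else 0)"

definition binom :: "int \<Rightarrow> int \<Rightarrow> rat" where
  "binom n r = multinom n [r, n - r]"

text \<open>In the next two definitions the division is exact, since \<open>\<bar>b\<bar> + b\<close> and \<open>\<bar>b\<bar> - b\<close> are even.\<close>

definition pos_part :: "int \<Rightarrow> int" where
  "pos_part b = (\<bar>b\<bar> + b) div 2"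

definition neg_part :: "int \<Rightarrow> int" where
  "neg_part b = (\<bar>b\<bar> - b) div 2"

text \<open>
  The intended domain is \<open>s \<ge> a \<ge> 0\<close> and \<open>s \<ge> l\<close>. Outside of it the value is irrelevant: it only
  ever occurs multiplied by a vanishing multinomial coefficient.
\<close>

definition beta :: "int \<Rightarrow> int \<Rightarrow> int \<Rightarrow> int \<Rightarrow> int \<Rightarrow> rat" where
  "beta m s l a b =
     (\<Sum>n = 0..\<bar>b\<bar> + m.
        binom (s - a) (pos_part b + m - n) * binom a (neg_part b + m - n) * binom (s - l + n) n)"

lemma binom_eq_choose:
  assumes "n \<ge> 0"
  shows "binom n r = (if r < 0 then 0 else of_nat (nat n choose nat r))"
proof (cases "0 \<le> r \<and> r \<le> n")
  case True
  then have "nat r \<le> nat n" "nat (n - r) = nat n - nat r" by auto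
  then show ?thesis
    using True by (simp add: binom_def multinom_def binomial_fact)
next
  case False
  then show ?thesis
    using assms by (auto simp: binom_def multinom_def)
qed

end

theory Submission
  imports Defs "HOL-Computational_Algebra.Formal_Power_Series"
begin

text \<open>
  Let \<open>N = s - l\<close>. The three families of terms on the left-hand side are the parts \<open>e > f\<close>,
  \<open>e < f\<close> and \<open>e = f\<close> of one family indexed by \<open>e, f \<ge> 0\<close> with \<open>e + f \<le> l\<close>: with \<open>k = l - e - f\<close>,
  \<open>p = j - l + f\<close> and \<open>q = N - k - p\<close>, the term is \<open>(-2)^k\<close> times the trinomial coefficient of
  \<open>k, p, q\<close> times \<open>\<Sum>n. (k+q+e choose e-n) (k+p+f choose f-n) (N+n choose n)\<close>.
  Summing negative binomial series, the last factor is the coefficient of \<open>X^e Y^f\<close> in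
  \<open>(1-X)^p (1-Y)^q / (1-X-Y)^(N+1)\<close>. Hence the whole sum is the coefficient of \<open>X^j Y^(s-j)\<close> in
  \<open>(X(1-X) + Y(1-Y) - 2XY)^N / (1-X-Y)^(N+1)\<close>. As the base of the numerator factors as
  \<open>(X+Y)(1-X-Y)\<close>, this series is \<open>(X+Y)^N / (1-X-Y)\<close>, whose homogeneous part of degree
  \<open>s \<ge> N\<close> is \<open>(X+Y)^s\<close>.
\<close>

unbundle fps_syntax

subsection \<open>The geometric series\<close>

definition fps_geometric :: "'a::one fps" where
  "fps_geometric = Abs_fps (\<lambda>_. 1)"

lemma one_minus_fps_X_mult_geometric: "(1 - fps_X) * fps_geometric = (1 :: 'a::ring_1 fps)"
  by (simp add: fps_eq_iff fps_geometric_def left_diff_distrib)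

lemma fps_geometric_power_nth:
  "(fps_geometric ^ Suc r :: 'a::semiring_1 fps) $ n = of_nat (r + n choose n)"
proof (induction r arbitrary: n)
  case 0
  then show ?case by (simp add: fps_geometric_def)
next
  case (Suc r)
  have "(fps_geometric ^ Suc (Suc r) :: 'a fps) $ n = (fps_geometric ^ Suc r * fps_geometric) $ n"
    by (simp only: power_Suc2)
  also have "\<dots> = (\<Sum>i\<le>n. of_nat (r + i choose i))"
    by (simp only: fps_mult_nth Suc) (simp add: fps_geometric_def atLeast0AtMost)
  also have "\<dots> = of_nat (Suc (r + n) choose n)"
    by (simp only: flip: of_nat_sum sum_choose_lower)
  finally show ?case by simp
qed

lemma fps_compose_mult_nth:
  fixes a b c :: "'a::comm_ring_1 fps"
  assumes "b $ 0 = 0"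
  shows "((a oo b) * c) $ n = (\<Sum>i\<le>n. a $ i * (b ^ i * c) $ n)"
proof -
  have compose_nth: "(a oo b) $ k = (\<Sum>i\<le>n. a $ i * (b ^ i $ k))" if "k \<le> n" for k
    unfolding fps_compose_nth using that
    by (intro sum.mono_neutral_left) (auto simp: startsby_zero_power_prefix[OF assms])
  have "((a oo b) * c) $ n = (\<Sum>k=0..n. \<Sum>i\<le>n. a $ i * (b ^ i $ k) * c $ (n - k))"
    by (simp add: fps_mult_nth compose_nth sum_distrib_right)
  also have "\<dots> = (\<Sum>i\<le>n. a $ i * (b ^ i * c) $ n)"
    by (subst sum.swap) (simp add: fps_mult_nth sum_distrib_left mult.assoc)
  finally show ?thesis .
qed

lemma one_minus_mult_geometric_compose:
  fixes z :: "'a::idom fps"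
  assumes "z $ 0 = 0"
  shows "(1 - z) * (fps_geometric oo z) = 1"
proof -
  have "(1 - z) * (fps_geometric oo z) = ((1 - fps_X) * fps_geometric) oo z"
    by (simp add: assms fps_compose_mult_distrib fps_compose_sub_distrib)
  then show ?thesis
    by (simp add: one_minus_fps_X_mult_geometric)
qed

subsection \<open>Bivariate series and Pascal's triangle\<close>

text \<open>
  Bivariate series are power series in \<open>X\<close> whose coefficients are power series in \<open>Y\<close>, so the
  coefficient of \<open>X^a Y^b\<close> in \<open>F\<close> is \<open>F $ a $ b\<close>.
\<close>

abbreviation fps_Y :: "'a::comm_ring_1 fps fps" where
  "fps_Y \<equiv> fps_const fps_X"

abbreviation fps_geometric_Y :: "'a::comm_ring_1 fps fps" where
  "fps_geometric_Y \<equiv> fps_const fps_geometric"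

definition fps_pascal :: "'a::comm_ring_1 fps fps" where
  "fps_pascal = Abs_fps (\<lambda>a. Abs_fps (\<lambda>b. of_nat (a + b choose a)))"

lemma fps_pascal_nth [simp]: "fps_pascal $ a $ b = of_nat (a + b choose a)"
  by (simp add: fps_pascal_def)

lemma fps_X_Y_power_mult_nth:
  "(fps_X ^ u * fps_Y ^ v * F) $ a $ b = (if u \<le> a \<and> v \<le> b then F $ (a - u) $ (b - v) else 0)"
  by (simp add: mult.assoc fps_X_power_mult_nth)

lemma one_minus_fps_Y_mult_geometric_Y: "(1 - fps_Y) * fps_geometric_Y = 1"
proof -
  have "(1 - fps_Y) * fps_geometric_Y = fps_const ((1 - fps_X) * fps_geometric)"
    by (simp only: flip: fps_const_mult fps_const_sub fps_const_1_eq_1)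
  then show ?thesis
    by (simp only: one_minus_fps_X_mult_geometric fps_const_1_eq_1)
qed

lemma one_minus_X_minus_Y_mult_pascal: "(1 - fps_X - fps_Y) * fps_pascal = 1"
proof (intro fps_ext)
  fix a b
  show "((1 - fps_X - fps_Y) * fps_pascal) $ a $ b = (1 :: 'a fps fps) $ a $ b"
    by (cases a; cases b) (simp_all add: left_diff_distrib)
qed

lemma X_plus_Y_power_mult_pascal_nth:
  "N \<le> a + b \<Longrightarrow> ((fps_X + fps_Y) ^ N * fps_pascal) $ a $ b = of_nat (a + b choose a)"
proof (induction N arbitrary: a b)
  case (Suc N)
  define F :: "'a fps fps" where "F = (fps_X + fps_Y) ^ N * fps_pascal"
  have IH: "F $ a $ b = of_nat (a + b choose a)" if "N \<le> a + b" for a b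
    using Suc.IH[OF that] by (simp add: F_def)
  have "(fps_X + fps_Y) ^ Suc N * fps_pascal = fps_X * F + fps_Y * F"
    by (simp add: F_def algebra_simps)
  then show ?case
    using Suc.prems by (cases a; cases b) (simp_all add: IH)
qed simp

subsection \<open>A generating function for the beta coefficients\<close>

definition nat_beta :: "nat \<Rightarrow> nat \<Rightarrow> nat \<Rightarrow> nat \<Rightarrow> nat \<Rightarrow> nat" where
  "nat_beta N u v e f =
     (\<Sum>n\<le>min e f. (u choose (e - n)) * (v choose (f - n)) * (N + n choose n))"

definition fps_XY_quotient :: "'a::comm_ring_1 fps fps" where
  "fps_XY_quotient = fps_X * fps_Y * fps_geometric * fps_geometric_Y"

lemma fps_XY_quotient_nth_0: "fps_XY_quotient $ 0 = 0"
  by (simp add: fps_XY_quotient_def mult.assoc)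

lemma fps_XY_quotient_power_mult_geometric_nth:
  "((fps_XY_quotient :: 'a::comm_ring_1 fps fps) ^ n *
      (fps_geometric ^ Suc u * fps_geometric_Y ^ Suc v)) $ e $ f =
    (if n \<le> min e f then of_nat ((u + e choose (e - n)) * (v + f choose (f - n))) else 0)"
proof -
  have "(fps_XY_quotient :: 'a fps fps) ^ n * (fps_geometric ^ Suc u * fps_geometric_Y ^ Suc v) =
      fps_X ^ n * fps_Y ^ n * (fps_geometric ^ Suc (u + n) * fps_geometric_Y ^ Suc (v + n))"
    by (simp only: fps_XY_quotient_def power_mult_distrib power_add power_Suc mult_ac)
  moreover have "(fps_geometric ^ Suc (u + n) * fps_geometric_Y ^ Suc (v + n)) $ (e - n) $ (f - n) =
      (of_nat ((u + e choose (e - n)) * (v + f choose (f - n))) :: 'a)" if "n \<le> min e f"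
    using that by (simp add: fps_geometric_power_nth del: power_Suc)
  ultimately show ?thesis
    by (simp only: fps_X_Y_power_mult_nth min.bounded_iff cong: if_cong)
qed

text \<open>This rests on \<open>1-X-Y = (1-X)(1-Y)(1-z)\<close>, where \<open>z = XY / ((1-X)(1-Y))\<close>.\<close>

lemma fps_pascal_eq_compose:
  "fps_pascal = fps_geometric * fps_geometric_Y *
     (fps_geometric oo (fps_XY_quotient :: 'a::idom fps fps))"
proof -
  define A B :: "'a fps fps" where "A = fps_geometric" and "B = fps_geometric_Y"
  define z :: "'a fps fps" where "z = fps_XY_quotient"
  have z_eq: "z = fps_X * fps_Y * A * B"
    by (simp only: z_def fps_XY_quotient_def A_def B_def)
  have "1 - z = ((1 - fps_X) * A) * ((1 - fps_Y) * B) - z"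
    by (simp add: A_def B_def one_minus_fps_X_mult_geometric one_minus_fps_Y_mult_geometric_Y)
  also have "\<dots> = A * B * (1 - fps_X - fps_Y)"
    by (simp add: z_eq algebra_simps)
  finally have pascal_factor: "(1 - z) * fps_pascal = A * B"
    by (simp add: mult.assoc one_minus_X_minus_Y_mult_pascal)
  have "fps_pascal = fps_pascal * ((1 - z) * (fps_geometric oo z))"
    by (simp add: one_minus_mult_geometric_compose z_def fps_XY_quotient_nth_0)
  also have "\<dots> = A * B * (fps_geometric oo z)"
    by (simp only: mult_ac flip: pascal_factor)
  finally show ?thesis
    by (simp only: A_def B_def z_def)
qed

lemma fps_pascal_power_eq_compose:
  "(1 - fps_X) ^ p * (1 - fps_Y) ^ q * fps_pascal ^ Suc (k + p + q) =
     (fps_geometric ^ Suc (k + p + q) oo (fps_XY_quotient :: 'a::idom fps fps)) *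
     (fps_geometric ^ Suc (k + q) * fps_geometric_Y ^ Suc (k + p))"
proof -
  define A B :: "'a fps fps" where "A = fps_geometric" and "B = fps_geometric_Y"
  define G :: "'a fps fps" where "G = fps_geometric oo fps_XY_quotient"
  have "(1 - fps_X) ^ p * (1 - fps_Y) ^ q * fps_pascal ^ Suc (k + p + q) =
      (1 - fps_X) ^ p * (1 - fps_Y) ^ q * (A * B * G) ^ Suc (k + p + q)"
    by (simp only: A_def B_def G_def flip: fps_pascal_eq_compose)
  also have "\<dots> = ((1 - fps_X) * A) ^ p * ((1 - fps_Y) * B) ^ q *
      (G ^ Suc (k + p + q) * (A ^ Suc (k + q) * B ^ Suc (k + p)))"
    by (simp only: power_add power_mult_distrib power_Suc mult_ac)
  also have "\<dots> = G ^ Suc (k + p + q) * (A ^ Suc (k + q) * B ^ Suc (k + p))"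
    by (simp only: A_def B_def one_minus_fps_X_mult_geometric one_minus_fps_Y_mult_geometric_Y
        power_one mult_1_left)
  finally show ?thesis
    by (simp only: A_def B_def G_def fps_compose_power[OF fps_XY_quotient_nth_0])
qed

lemma nat_beta_generating_function:
  "((1 - fps_X) ^ p * (1 - fps_Y) ^ q * fps_pascal ^ Suc (k + p + q)) $ e $ f =
    (of_nat (nat_beta (k + p + q) (k + q + e) (k + p + f) e f) :: 'a::idom)"
proof -
  let ?c = "\<lambda>n. (k + q + e choose (e - n)) * (k + p + f choose (f - n))"
  have "((1 - fps_X) ^ p * (1 - fps_Y) ^ q * fps_pascal ^ Suc (k + p + q)) $ e $ f =
      (\<Sum>n\<le>e. of_nat (k + p + q + n choose n) * (if n \<le> min e f then of_nat (?c n) else 0 :: 'a))"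
    unfolding fps_pascal_power_eq_compose fps_compose_mult_nth[OF fps_XY_quotient_nth_0]
      fps_sum_nth fps_geometric_power_nth[of "k + p + q"] fps_mult_of_nat_nth
      fps_XY_quotient_power_mult_geometric_nth ..
  also have "\<dots> = (\<Sum>n\<le>min e f. of_nat (k + p + q + n choose n) * of_nat (?c n))"
    by (rule sum.mono_neutral_cong_right) auto
  also have "\<dots> = of_nat (nat_beta (k + p + q) (k + q + e) (k + p + f) e f)"
    by (simp add: nat_beta_def mult_ac)
  finally show ?thesis .
qed

subsection \<open>The identity for natural numbers\<close>

definition trinomial :: "nat \<Rightarrow> nat \<Rightarrow> nat \<Rightarrow> nat" where
  "trinomial k p q = (k + p + q choose k) * (p + q choose p)"

lemma finite_nat_triples_sum_eq: "finite {(k, p, q). k + p + q = (N :: nat)}"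
  by (rule finite_subset[of _ "{..N} \<times> {..N} \<times> {..N}"]) auto

lemma trinomial_ring:
  fixes a b c :: "'a::comm_semiring_1"
  shows "(a + b + c) ^ N =
    (\<Sum>(k, p, q) \<in> {(k, p, q). k + p + q = N}. of_nat (trinomial k p q) * (a ^ k * b ^ p * c ^ q))"
proof -
  have "(a + b + c) ^ N = (\<Sum>k\<le>N. of_nat (N choose k) * a ^ k * (b + c) ^ (N - k))"
    by (simp only: add.assoc binomial_ring[of a])
  also have "\<dots> = (\<Sum>k\<le>N. \<Sum>p\<le>N - k.
      of_nat ((N choose k) * (N - k choose p)) * (a ^ k * b ^ p * c ^ (N - k - p)))"
    by (simp add: binomial_ring[of b] sum_distrib_left mult_ac)
  also have "\<dots> = (\<Sum>(k, p) \<in> Sigma {..N} (\<lambda>k. {..N - k}).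
      of_nat ((N choose k) * (N - k choose p)) * (a ^ k * b ^ p * c ^ (N - k - p)))"
    by (rule sum.Sigma) simp_all
  also have "\<dots> = (\<Sum>(k, p, q) \<in> {(k, p, q). k + p + q = N}.
      of_nat (trinomial k p q) * (a ^ k * b ^ p * c ^ q))"
    by (rule sum.reindex_bij_witness[of _ "\<lambda>(k, p, q). (k, p)" "\<lambda>(k, p). (k, p, N - k - p)"])
       (auto simp: trinomial_def)
  finally show ?thesis .
qed

lemma X_plus_Y_power_mult_pascal_expansion:
  "(fps_X + fps_Y) ^ N * fps_pascal =
    (\<Sum>(k, p, q) \<in> {(k, p, q). k + p + q = N}. of_int ((-2) ^ k * int (trinomial k p q)) *
       (fps_X ^ (k + p) * fps_Y ^ (k + q) *
        ((1 - fps_X) ^ p * (1 - fps_Y) ^ q * fps_pascal ^ Suc N)))"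
proof -
  have factorization: "(fps_X + fps_Y) * (1 - fps_X - fps_Y) =
      (-2) * fps_X * fps_Y + fps_X * (1 - fps_X) + fps_Y * (1 - fps_Y)"
    by (simp add: algebra_simps del: fps_const_mult)
  have "(fps_X + fps_Y) ^ N * fps_pascal =
      ((fps_X + fps_Y) * ((1 - fps_X - fps_Y) * fps_pascal)) ^ N * fps_pascal"
    by (simp add: one_minus_X_minus_Y_mult_pascal)
  also have "\<dots> = ((fps_X + fps_Y) * (1 - fps_X - fps_Y)) ^ N * fps_pascal ^ Suc N"
    by (simp only: power_mult_distrib power_Suc mult_ac)
  also have "\<dots> = (\<Sum>(k, p, q) \<in> {(k, p, q). k + p + q = N}. of_nat (trinomial k p q) *
      (((-2) * fps_X * fps_Y) ^ k * (fps_X * (1 - fps_X)) ^ p * (fps_Y * (1 - fps_Y)) ^ q) *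
      fps_pascal ^ Suc N)"
    unfolding factorization trinomial_ring by (simp only: sum_distrib_right case_prod_unfold)
  also have "\<dots> = (\<Sum>(k, p, q) \<in> {(k, p, q). k + p + q = N}.
      of_int ((-2) ^ k * int (trinomial k p q)) * (fps_X ^ (k + p) * fps_Y ^ (k + q) *
        ((1 - fps_X) ^ p * (1 - fps_Y) ^ q * fps_pascal ^ Suc N)))"
    by (simp only: of_int_mult of_int_power of_int_minus of_int_numeral of_int_of_nat_eq
        power_mult_distrib power_add mult_ac)
  finally show ?thesis .
qed

lemma sum_trinomial_nat_beta:
  assumes "N \<le> a + b"
  shows "(\<Sum>(k, p, q) \<in> {(k, p, q). k + p + q = N \<and> k + p \<le> a \<and> k + q \<le> b}.
      (-2) ^ k * int (trinomial k p q) *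
      int (nat_beta N (a + q - p) (b + p - q) (a - (k + p)) (b - (k + q)))) = int (a + b choose a)"
    (is "sum ?t ?Q = _")
proof -
  define F :: "nat \<Rightarrow> nat \<Rightarrow> int fps fps" where
    "F p q = (1 - fps_X) ^ p * (1 - fps_Y) ^ q * fps_pascal ^ Suc N" for p q
  have F_nth: "F p q $ (a - (k + p)) $ (b - (k + q)) =
      int (nat_beta N (a + q - p) (b + p - q) (a - (k + p)) (b - (k + q)))"
    if "k + p + q = N" "k + p \<le> a" "k + q \<le> b" for k p q
  proof -
    have "k + q + (a - (k + p)) = a + q - p" "k + p + (b - (k + q)) = b + p - q"
      using that by auto
    then show ?thesis
      unfolding F_def using that(1) nat_beta_generating_function[of p q k, where 'a = int] by metis
  qed
  let ?T = "{(k, p, q). k + p + q = N}"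
  have "int (a + b choose a) = ((fps_X + fps_Y) ^ N * fps_pascal) $ a $ b"
    by (simp add: X_plus_Y_power_mult_pascal_nth[OF assms])
  also have "\<dots> = (\<Sum>(k, p, q) \<in> ?T. (of_int ((-2) ^ k * int (trinomial k p q)) *
      (fps_X ^ (k + p) * fps_Y ^ (k + q) * F p q)) $ a $ b)"
    unfolding X_plus_Y_power_mult_pascal_expansion F_def by (simp only: fps_sum_nth case_prod_unfold)
  also have "\<dots> = (\<Sum>(k, p, q) \<in> ?T. (-2) ^ k * int (trinomial k p q) *
      (if k + p \<le> a \<and> k + q \<le> b then F p q $ (a - (k + p)) $ (b - (k + q)) else 0))"
    by (simp only: fps_mult_of_int_nth fps_X_Y_power_mult_nth of_int_eq_id id_apply)
  also have "\<dots> = sum ?t ?Q"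
    by (rule sum.mono_neutral_cong_right[OF finite_nat_triples_sum_eq])
       (auto simp: F_nth split: if_splits)
  finally show ?thesis ..
qed

subsection \<open>From natural numbers to integers\<close>

definition triangle :: "int \<Rightarrow> (int \<times> int) set" where
  "triangle l = {(e, f). 0 \<le> e \<and> 0 \<le> f \<and> e + f \<le> l}"

lemma finite_triangle: "finite (triangle l)"
  by (rule finite_subset[of _ "{0..l} \<times> {0..l}"]) (auto simp: triangle_def)

lemma sum_triangle_by_diagonals:
  fixes g :: "int \<Rightarrow> int \<Rightarrow> 'a::comm_monoid_add"
  shows "(\<Sum>(e, f) \<in> triangle l. g e f) =
    (\<Sum>m = 0..(l - 1) div 2. \<Sum>i = 2 * m..l - 1. g (l - i + m) m + g m (l - i + m)) +
    (\<Sum>m = 0..l div 2. g m m)"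
proof -
  let ?g = "\<lambda>(e, f). g e f"
  let ?I = "Sigma {0..(l - 1) div 2} (\<lambda>m. {2 * m..l - 1})"
  let ?below = "{(e, f) \<in> triangle l. f < e}" and ?above = "{(e, f) \<in> triangle l. e < f}"
    and ?diagonal = "{(e, f) \<in> triangle l. e = f}"
  have finite_part: "finite {(e, f) \<in> triangle l. P e f}" for P
    by (rule finite_subset[OF _ finite_triangle]) auto
  have "(\<Sum>m = 0..(l - 1) div 2. \<Sum>i = 2 * m..l - 1. g (l - i + m) m + g m (l - i + m)) =
      (\<Sum>(m, i) \<in> ?I. g (l - i + m) m) + (\<Sum>(m, i) \<in> ?I. g m (l - i + m))"
    by (simp add: sum.Sigma sum.distrib)
  also have "(\<Sum>(m, i) \<in> ?I. g (l - i + m) m) = sum ?g ?below"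
    by (rule sum.reindex_bij_witness[of _ "\<lambda>(e, f). (f, l - e + f)" "\<lambda>(m, i). (l - i + m, m)"])
       (auto simp: triangle_def)
  also have "(\<Sum>(m, i) \<in> ?I. g m (l - i + m)) = sum ?g ?above"
    by (rule sum.reindex_bij_witness[of _ "\<lambda>(e, f). (e, l - f + e)" "\<lambda>(m, i). (m, l - i + m)"])
       (auto simp: triangle_def)
  finally have off_diagonal: "(\<Sum>m = 0..(l - 1) div 2. \<Sum>i = 2 * m..l - 1.
      g (l - i + m) m + g m (l - i + m)) = sum ?g ?below + sum ?g ?above" .
  have diagonal: "(\<Sum>m = 0..l div 2. g m m) = sum ?g ?diagonal"
    by (rule sum.reindex_bij_witness[of _ fst "\<lambda>m. (m, m)"]) (auto simp: triangle_def)
  have "sum ?g (triangle l) = sum ?g ((?below \<union> ?above) \<union> ?diagonal)"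
    by (rule sum.cong) auto
  also have "\<dots> = sum ?g (?below \<union> ?above) + sum ?g ?diagonal"
    by (rule sum.union_disjoint; (intro finite_UnI finite_part)?) auto
  also have "sum ?g (?below \<union> ?above) = sum ?g ?below + sum ?g ?above"
    by (rule sum.union_disjoint; (intro finite_part)?) auto
  finally show ?thesis
    unfolding off_diagonal diagonal .
qed

definition summand :: "int \<Rightarrow> int \<Rightarrow> int \<Rightarrow> int \<Rightarrow> int \<Rightarrow> rat" where
  "summand s l j e f = (-2) ^ nat (l - e - f) *
     multinom (s - l) [l - e - f, j - l + f, s - l - j + e] *
     beta (min e f) s l (j - e + f) (e - f)"

lemma summand_eq_0:
  assumes "l < e + f \<or> j - l + f < 0 \<or> s - l - j + e < 0"
  shows "summand s l j e f = 0"
  using assms by (auto simp: summand_def multinom_def)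

lemma multinom_eq_trinomial:
  "multinom (int (k + p + q)) [int k, int p, int q] = of_nat (trinomial k p q)"
  by (simp add: multinom_def trinomial_def binomial_fact nat_add_distrib add.assoc flip: of_nat_add)

lemma binom_of_nat: "binom (int n) (int r) = of_nat (n choose r)"
  by (simp add: binom_eq_choose)

lemma beta_eq_nat_beta:
  "beta (min (int e) (int f)) (int (u + v)) (int (u + v) - int N) (int v) (int e - int f) =
     of_nat (nat_beta N u v e f)"
proof -
  let ?h = "\<lambda>n. binom (int u) (int e - n) * binom (int v) (int f - n) * binom (int N + n) n"
  have "pos_part (int e - int f) + min (int e) (int f) = int e"
    and "neg_part (int e - int f) + min (int e) (int f) = int f"
    by (auto simp: pos_part_def neg_part_def)
  then have "beta (min (int e) (int f)) (int (u + v)) (int (u + v) - int N) (int v) (int e - int f) =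
      (\<Sum>n = 0..\<bar>int e - int f\<bar> + min (int e) (int f). ?h n)"
    by (simp add: beta_def)
  also have "\<dots> = (\<Sum>n = 0..int (min e f). ?h n)"
    by (rule sum.mono_neutral_right) (auto simp: binom_eq_choose)
  also have "\<dots> = (\<Sum>n\<le>min e f. ?h (int n))"
    by (rule sum.reindex_bij_witness[of _ int nat]) auto
  also have "\<dots> = of_nat (nat_beta N u v e f)"
    unfolding nat_beta_def of_nat_sum
    by (intro sum.cong) (auto simp: binom_of_nat simp flip: of_nat_diff of_nat_add)
  finally show ?thesis .
qed

lemma summand_of_nat:
  assumes "k + p + q = N" "k + p \<le> a" "k + q \<le> b"
    and "s = int (a + b)" "l = s - int N" "j = int a"
  shows "summand s l j (j - int (k + p)) (s - j - int (k + q)) =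
    of_int ((-2) ^ k * int (trinomial k p q) *
      int (nat_beta N (a + q - p) (b + p - q) (a - (k + p)) (b - (k + q))))"
proof -
  obtain e f where ef: "a = k + p + e" "b = k + q + f"
    using assms(2,3) by (auto simp: le_iff_add)
  let ?u = "k + q + e" and ?v = "k + p + f"
  have "summand s l j (j - int (k + p)) (s - j - int (k + q)) = (-2) ^ k *
      multinom (int (k + p + q)) [int k, int p, int q] *
      beta (min (int e) (int f)) (int (?u + ?v)) (int (?u + ?v) - int N) (int ?v) (int e - int f)"
    by (simp add: summand_def ef assms(4-6) algebra_simps flip: assms(1))
  then show ?thesis
    unfolding multinom_eq_trinomial beta_eq_nat_beta by (simp add: ef add_ac)
qed

lemma sum_summand_of_nat:
  assumes "N \<le> a + b" "s = int (a + b)" "l = s - int N" "j = int a"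
  shows "(\<Sum>(e, f) \<in> triangle l. summand s l j e f) = of_nat (a + b choose a)"
proof -
  let ?Q = "{(k, p, q). k + p + q = N \<and> k + p \<le> a \<and> k + q \<le> b}"
  let ?E = "{(e, f) \<in> triangle l. 0 \<le> j - l + f \<and> 0 \<le> s - l - j + e}"
  have "(of_nat (a + b choose a) :: rat) = of_int (int (a + b choose a))"
    by simp
  also have "\<dots> = (\<Sum>(k, p, q) \<in> ?Q. summand s l j (j - int (k + p)) (s - j - int (k + q)))"
    unfolding sum_trinomial_nat_beta[OF assms(1), symmetric] of_int_sum
    by (intro sum.cong refl) (auto simp only: summand_of_nat[OF _ _ _ assms(2-4)])
  also have "\<dots> = (\<Sum>(e, f) \<in> ?E. summand s l j e f)"
    by (rule sum.reindex_bij_witness[of _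
          "\<lambda>(e, f). (nat (l - e - f), nat (j - l + f), nat (s - l - j + e))"
          "\<lambda>(k, p, q). (j - int (k + p), s - j - int (k + q))"])
       (auto simp: triangle_def assms)
  also have "\<dots> = (\<Sum>(e, f) \<in> triangle l. summand s l j e f)"
    by (rule sum.mono_neutral_left[OF finite_triangle]) (auto intro!: summand_eq_0)
  finally show ?thesis ..
qed

lemma sum_summand:
  assumes "s \<ge> l" "l \<ge> 0"
  shows "(\<Sum>(e, f) \<in> triangle l. summand s l j e f) = binom s j"
proof (cases "0 \<le> j \<and> j \<le> s")
  case True
  then have "binom s j = of_nat (nat j + nat (s - j) choose nat j)"
    by (simp add: binom_eq_choose flip: nat_add_distrib)
  also have "\<dots> = (\<Sum>(e, f) \<in> triangle l. summand s l j e f)"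
    by (rule sum_summand_of_nat[where N = "nat (s - l)", symmetric]) (use True assms in auto)
  finally show ?thesis ..
next
  case False
  then have "(\<Sum>(e, f) \<in> triangle l. summand s l j e f) = 0"
    by (intro sum.neutral) (auto simp: triangle_def intro!: summand_eq_0)
  with False assms show ?thesis
    by (auto simp: binom_eq_choose)
qed

lemma summand_below_diagonal:
  assumes "i \<le> l"
  shows "summand s l j (l - i + m) m = (-2) ^ nat (i - 2 * m) *
    (multinom (s - l) [i - 2 * m, j - l + m, s - i - j + m] * beta m s l (i + j - l) (l - i))"
  using assms by (simp add: summand_def min_def algebra_simps)

lemma summand_above_diagonal:
  assumes "i \<le> l"
  shows "summand s l j m (l - i + m) = (-2) ^ nat (i - 2 * m) *
    (multinom (s - l) [i - 2 * m, j - i + m, s - l - j + m] * beta m s l (l + j - i) (i - l))"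
  using assms by (simp add: summand_def min_def algebra_simps)

theorem theorem1p1:
  fixes s l j :: int
  assumes "s \<ge> l" and "l \<ge> 0"
  shows "(\<Sum>m = 0..\<lfloor>of_int (l - 1) / (2::rat)\<rfloor>. \<Sum>i = 2 * m..l - 1.
            (-2) ^ nat (i - 2 * m) *
              (multinom (s - l) [i - 2 * m, j - l + m, s - i - j + m]
                 * beta m s l (i + j - l) (l - i)
             + multinom (s - l) [i - 2 * m, j - i + m, s - l - j + m]
                 * beta m s l (l + j - i) (i - l)))
       + (\<Sum>m = 0..\<lfloor>of_int l / (2::rat)\<rfloor>.
            (-2) ^ nat (l - 2 * m) *
              multinom (s - l) [l - 2 * m, j - l + m, s - l - j + m]
                * beta m s l j 0)
       = binom s j"
    (is "?off_diagonal + ?diagonal = _")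
proof -
  have floor_half: "\<lfloor>of_int z / (2::rat)\<rfloor> = z div 2" for z :: int
    using floor_divide_of_int_eq[of z 2, where 'a = rat] by simp
  have "?off_diagonal = (\<Sum>m = 0..(l - 1) div 2. \<Sum>i = 2 * m..l - 1.
      summand s l j (l - i + m) m + summand s l j m (l - i + m))"
    unfolding floor_half
    by (intro sum.cong refl) (simp add: distrib_left summand_below_diagonal summand_above_diagonal)
  moreover have "?diagonal = (\<Sum>m = 0..l div 2. summand s l j m m)"
    unfolding floor_half by (simp add: summand_def mult.assoc)
  ultimately have "?off_diagonal + ?diagonal = (\<Sum>(e, f) \<in> triangle l. summand s l j e f)"
    by (simp only: sum_triangle_by_diagonals)
  also have "\<dots> = binom s j"
    using assms by (rule sum_summand)
  finally show ?thesis .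
qed

end
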